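(* Let $\mathcal{A}$ be a real symmetric tensor of order $m$ and dimension $n$. Then the following are equivalent: (i) $\mathcal{A}$ is an almost semi-positive tensor (almost $\mathbf{E_0}$-tensor); (ii) $\mathcal{A}$ is an almost copositive tensor (almost $\mathbf{C_0}$-tensor).
   Context: A real tensor of order $m$ ($m\ge 2$) and dimension $n$ is an array $\mathcal{A}=(a_{i_1\ldots i_m})$ with $a_{i_1\ldots i_m}\in\mathbb{R}$, $i_1,\ldots,i_m\in I_n=\{1,\ldots,n\}$. It is symmetric if its entries are invariant under all permutations of their indices. For $\mathbf{x}\in\mathbb{R}^n$, $\mathcal{A}\mathbf{x}^{m-1}\in\mathbb{R}^n$ is defined by $(\mathcal{A}\mathbf{x}^{m-1})_i=\sum_{i_2,\ldots,i_m=1}^n a_{i i_2\ldots i_m}x_{i_2}\cdots x_{i_m}$, and $\mathcal{A}\mathbf{x}^m=\sum_{i=1}^n x_i(\mathcal{A}\mathbf{x}^{m-1})_i$. Vector inequalities are componentwise. For nonempty $J\subseteq I_n$, the principal subtensor of $\mathcal{A}$ indexed by $J$ is the tensor of order $m$ and dimension $|J|$ with entries $a_{i_1\ldots i_m}$, $i_1,\ldots,i_m\in J$; it is proper if $J\neq I_n$. $\mathcal{A}$ is semi-positive ($\mathbf{E_0}$-tensor) if for each $\mathbf{x}\ge\mathbf{0}$, $\mathbf{x}\ne\mathbf{0}$, there is $k\in I_n$ with $x_k>0$ and $(\mathcal{A}\mathbf{x}^{m-1})_k\ge 0$. $\mathcal{A}$ is almost semi-positive (almost $\mathbf{E_0}$-tensor)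 if every proper principal subtensor of $\mathcal{A}$ is semi-positive and there is $\mathbf{x}>\mathbf{0}$ with $\mathcal{A}\mathbf{x}^{m-1}<\mathbf{0}$. $\mathcal{A}$ is copositive ($\mathbf{C_0}$-tensor) if $\mathcal{A}\mathbf{x}^m\ge 0$ for all $\mathbf{x}\ge\mathbf{0}$. $\mathcal{A}$ is almost copositive (almost $\mathbf{C_0}$-tensor) if $\mathcal{A}$ is not copositive but each of its proper principal subtensors is copositive. *)

theory Defs
  imports "HOL-Analysis.Analysis" "HOL-Combinatorics.Combinatorics"
begin

text \<open>
  A tensor of order \<open>m\<close> over a finite index set \<open>I\<close> is a function \<open>A :: 'i list \<Rightarrow> real\<close> of which
  only the entries \<open>A is\<close> with \<open>is \<in> multi_indices m I\<close> matter. The index set is a set rather than a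
  number or a type, so that a principal subtensor is again a tensor, over its own index set \<open>J\<close>.
  Likewise, a real vector indexed by \<open>I\<close> is a function \<open>x :: 'i \<Rightarrow> real\<close> of which only the values
  on \<open>I\<close> matter; vector (in)equalities are therefore always relative to \<open>I\<close>.
\<close>

definition multi_indices :: "nat \<Rightarrow> 'i set \<Rightarrow> 'i list set" where
  "multi_indices m I = {is. length is = m \<and> set is \<subseteq> I}"

definition symmetric_tensor :: "nat \<Rightarrow> 'i set \<Rightarrow> ('i list \<Rightarrow> real) \<Rightarrow> bool" where
  "symmetric_tensor m I A \<longleftrightarrow>
     (\<forall>is\<in>multi_indices m I. \<forall>p. p permutes {..<m} \<longrightarrow> A (permute_list p is) = A is)"

text \<open>The component \<open>(A x\<^sup>m\<^sup>-\<^sup>1)\<^sub>i\<close>; it is meant for \<open>m \<ge> 1\<close>.\<close>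

definition tensor_vec :: "nat \<Rightarrow> 'i set \<Rightarrow> ('i list \<Rightarrow> real) \<Rightarrow> ('i \<Rightarrow> real) \<Rightarrow> 'i \<Rightarrow> real" where
  "tensor_vec m I A x i = (\<Sum>js\<in>multi_indices (m - 1) I. A (i # js) * prod_list (map x js))"

definition tensor_form :: "nat \<Rightarrow> 'i set \<Rightarrow> ('i list \<Rightarrow> real) \<Rightarrow> ('i \<Rightarrow> real) \<Rightarrow> real" where
  "tensor_form m I A x = (\<Sum>i\<in>I. x i * tensor_vec m I A x i)"

definition principal_subtensor :: "nat \<Rightarrow> 'i set \<Rightarrow> ('i list \<Rightarrow> real) \<Rightarrow> 'i list \<Rightarrow> real" where
  "principal_subtensor m J A = restrict A (multi_indices m J)"

definition semi_positive :: "nat \<Rightarrow> 'i set \<Rightarrow> ('i list \<Rightarrow> real) \<Rightarrow> bool" where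
  "semi_positive m I A \<longleftrightarrow>
     (\<forall>x. (\<forall>i\<in>I. x i \<ge> 0) \<and> (\<exists>i\<in>I. x i \<noteq> 0) \<longrightarrow>
          (\<exists>k\<in>I. x k > 0 \<and> tensor_vec m I A x k \<ge> 0))"

definition almost_semi_positive :: "nat \<Rightarrow> 'i set \<Rightarrow> ('i list \<Rightarrow> real) \<Rightarrow> bool" where
  "almost_semi_positive m I A \<longleftrightarrow>
     (\<forall>J. J \<noteq> {} \<and> J \<subset> I \<longrightarrow> semi_positive m J (principal_subtensor m J A)) \<and>
     (\<exists>x. (\<forall>i\<in>I. x i > 0) \<and> (\<forall>i\<in>I. tensor_vec m I A x i < 0))"

definition copositive :: "nat \<Rightarrow> 'i set \<Rightarrow> ('i list \<Rightarrow> real) \<Rightarrow> bool" where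
  "copositive m I A \<longleftrightarrow> (\<forall>x. (\<forall>i\<in>I. x i \<ge> 0) \<longrightarrow> tensor_form m I A x \<ge> 0)"

definition almost_copositive :: "nat \<Rightarrow> 'i set \<Rightarrow> ('i list \<Rightarrow> real) \<Rightarrow> bool" where
  "almost_copositive m I A \<longleftrightarrow>
     \<not> copositive m I A \<and>
     (\<forall>J. J \<noteq> {} \<and> J \<subset> I \<longrightarrow> copositive m J (principal_subtensor m J A))"

end

theory Submission
  imports Defs
begin

text \<open>
  For a symmetric tensor, semi-positivity and copositivity are the same property, and both
  directions rest on evaluating the form at a suitable vector.

  A vector \<open>x \<ge> 0\<close>, \<open>x \<noteq> 0\<close> whose components \<open>(A x\<^sup>m\<^sup>-\<^sup>1)\<^sub>k\<close> are negative on its whole support makes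
  the form \<open>A x\<^sup>m = \<Sum>\<^sub>k x\<^sub>k (A x\<^sup>m\<^sup>-\<^sup>1)\<^sub>k\<close> negative, so copositive tensors are semi-positive. Conversely,
  if \<open>A\<close> is not copositive, take a minimiser \<open>x\<close> of the form on the standard simplex; its value
  \<open>c = A x\<^sup>m\<close> is negative, and by homogeneity \<open>A y\<^sup>m \<ge> c (\<Sum>\<^sub>i y\<^sub>i)\<^sup>m\<close> for all \<open>y \<ge> 0\<close>, with equality at
  \<open>y = x\<close>. If \<open>x\<^sub>i > 0\<close>, one may move from \<open>x\<close> in both directions along the \<open>i\<close>-th axis, so the
  partial derivatives of the two sides agree at \<open>x\<close>. By symmetry of \<open>A\<close> this says
  \<open>m (A x\<^sup>m\<^sup>-\<^sup>1)\<^sub>i = m c\<close>, so \<open>(A x\<^sup>m\<^sup>-\<^sup>1)\<^sub>i = c < 0\<close> on the whole support of \<open>x\<close>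
  (lemma \<open>not_copositive_imp_negative_on_support\<close>).

  Thus the conditions on proper principal subtensors in the two almost-properties coincide. A vector
  \<open>x > 0\<close> with \<open>A x\<^sup>m\<^sup>-\<^sup>1 < 0\<close> refutes copositivity. If \<open>A\<close> is not copositive while its proper principal
  subtensors are, then the minimiser above has full support, since otherwise the principal subtensor
  on its support would have a negative value there; it is therefore a witness \<open>x > 0\<close> with
  \<open>A x\<^sup>m\<^sup>-\<^sup>1 < 0\<close>.
\<close>

section \<open>The homogeneous form of a tensor\<close>

lemma finite_multi_indices: "finite I \<Longrightarrow> finite (multi_indices m I)"
  using finite_lists_length_eq[of I m] by (simp add: multi_indices_def conj_commute)

lemma multi_indices_Suc:
  "multi_indices (Suc k) I = (\<lambda>(i, js). i # js) ` (I \<times> multi_indices k I)"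
  by (fastforce simp: multi_indices_def length_Suc_conv)

lemma multi_indices_nth: "is \<in> multi_indices m I \<Longrightarrow> l < m \<Longrightarrow> is ! l \<in> I"
  by (auto simp: multi_indices_def)

lemma prod_list_map_eq_prod: "prod_list (map x js) = (\<Prod>l<length js. x (js ! l))"
  by (induction js) (simp_all add: prod.lessThan_Suc_shift del: prod.lessThan_Suc)

lemma tensor_form_eq_sum:
  fixes I :: "'i set"
  assumes "m \<ge> 1"
  shows "tensor_form m I A x = (\<Sum>is\<in>multi_indices m I. A is * (\<Prod>l<m. x (is ! l)))"
proof -
  obtain k where m: "m = Suc k" using assms by (cases m) auto
  have inj: "inj_on (\<lambda>(i, js). i # js) (I \<times> multi_indices k I)"
    by (auto simp: inj_on_def)
  have "(\<Sum>is\<in>multi_indices m I. A is * (\<Prod>l<m. x (is ! l)))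
      = (\<Sum>is\<in>multi_indices m I. A is * prod_list (map x is))"
    by (intro sum.cong refl) (auto simp: prod_list_map_eq_prod multi_indices_def)
  also have "\<dots> = (\<Sum>(i, js)\<in>I \<times> multi_indices k I. A (i # js) * (x i * prod_list (map x js)))"
    unfolding m multi_indices_Suc
    by (subst sum.reindex[OF inj]) (auto simp: case_prod_unfold)
  also have "\<dots> = tensor_form m I A x"
    by (simp add: tensor_form_def tensor_vec_def m sum.cartesian_product sum_distrib_left
        mult.left_commute)
  finally show ?thesis by simp
qed

lemma tensor_form_cong:
  assumes "m \<ge> 1" and "\<And>i. i \<in> I \<Longrightarrow> x i = y i"
  shows "tensor_form m I A x = tensor_form m I A y"
  unfolding tensor_form_eq_sum[OF assms(1)]
  by (intro sum.cong refl arg_cong2[where f = "(*)"] prod.cong assms(2))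
    (auto dest: multi_indices_nth)

lemma tensor_form_scale:
  assumes "m \<ge> 1"
  shows "tensor_form m I A (\<lambda>i. c * x i) = c ^ m * tensor_form m I A x"
  unfolding tensor_form_eq_sum[OF assms]
  by (simp add: prod.distrib sum_distrib_left mult_ac)

lemma tensor_form_restrict_support:
  assumes "m \<ge> 1" and "finite I" and "S \<subseteq> I" and "\<And>i. i \<in> I - S \<Longrightarrow> x i = 0"
  shows "tensor_form m I A x = tensor_form m S A x"
  unfolding tensor_form_eq_sum[OF assms(1)]
proof (rule sum.mono_neutral_right)
  show "finite (multi_indices m I)" using assms(2) by (rule finite_multi_indices)
  show "multi_indices m S \<subseteq> multi_indices m I" using assms(3) by (auto simp: multi_indices_def)
  show "\<forall>is\<in>multi_indices m I - multi_indices m S. A is * (\<Prod>l<m. x (is ! l)) = 0"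
  proof
    fix "is" assume "is": "is \<in> multi_indices m I - multi_indices m S"
    then obtain l where "l < m" "is ! l \<in> I - S"
      by (auto simp: multi_indices_def subset_iff in_set_conv_nth)
    then have "\<exists>l\<in>{..<m}. x (is ! l) = 0" using assms(4) by auto
    then show "A is * (\<Prod>l<m. x (is ! l)) = 0" by simp
  qed
qed

section \<open>Principal subtensors\<close>

lemma tensor_vec_principal_subtensor:
  assumes "m \<ge> 1" and "i \<in> J"
  shows "tensor_vec m J (principal_subtensor m J A) x i = tensor_vec m J A x i"
  unfolding tensor_vec_def principal_subtensor_def
  using assms by (intro sum.cong refl) (auto simp: multi_indices_def)

lemma semi_positive_principal_subtensor:
  assumes "m \<ge> 1"
  shows "semi_positive m J (principal_subtensor m J A) \<longleftrightarrow> semi_positive m J A"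
  unfolding semi_positive_def using tensor_vec_principal_subtensor[OF assms] by metis

lemma copositive_principal_subtensor:
  assumes "m \<ge> 1"
  shows "copositive m J (principal_subtensor m J A) \<longleftrightarrow> copositive m J A"
proof -
  have "tensor_form m J (principal_subtensor m J A) x = tensor_form m J A x" for x
    unfolding tensor_form_def
    by (intro sum.cong refl) (simp add: tensor_vec_principal_subtensor[OF assms])
  then show ?thesis by (simp add: copositive_def)
qed

lemma symmetric_tensor_subset:
  "symmetric_tensor m I A \<Longrightarrow> J \<subseteq> I \<Longrightarrow> symmetric_tensor m J A"
  by (auto simp: symmetric_tensor_def multi_indices_def)

section \<open>The gradient of a symmetric form\<close>

text \<open>
  Fixing the index \<open>i\<close> in the \<open>k\<close>-th slot instead of the first one gives the same contraction:
  exchanging the slots \<open>0\<close> and \<open>k\<close> maps one sum to the other.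
\<close>

lemma symmetric_tensor_contract_slot:
  assumes "symmetric_tensor m I A" and "i \<in> I" and "k < m"
  shows "(\<Sum>is\<in>{is\<in>multi_indices m I. is ! k = i}. A is * (\<Prod>l\<in>{..<m} - {k}. x (is ! l)))
    = tensor_vec m I A x i"
proof -
  have m: "m \<ge> 1" using assms(3) by simp
  define \<tau> where "\<tau> = Transposition.transpose 0 k"
  have \<tau>: "\<tau> permutes {..<m}" unfolding \<tau>_def by (rule permutes_swap_id) (use assms(3) in auto)
  have \<tau>\<tau>: "\<tau> (\<tau> l) = l" for l by (simp add: \<tau>_def)
  have \<tau>_less: "\<tau> l < m \<longleftrightarrow> l < m" for l using permutes_in_image[OF \<tau>, of l] by simp
  have \<tau>_eq: "\<tau> l = k \<longleftrightarrow> l = 0" "\<tau> l = 0 \<longleftrightarrow> l = k" for l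
    by (simp_all add: \<tau>_def Transposition.transpose_def)
  have mem: "permute_list \<tau> is \<in> multi_indices m I" if "is \<in> multi_indices m I" for "is"
    using that \<tau> by (auto simp: multi_indices_def)
  have nth: "permute_list \<tau> is ! l = is ! \<tau> l" if "is \<in> multi_indices m I" "l < m" for "is" l
    using that \<tau> by (auto simp: multi_indices_def permute_list_nth)
  have inv: "permute_list \<tau> (permute_list \<tau> is) = is" if "is \<in> multi_indices m I" for "is"
    using that mem[OF that]
    by (intro nth_equalityI) (auto simp: multi_indices_def permute_list_nth \<tau> \<tau>\<tau> \<tau>_less)
  let ?B = "\<lambda>k. {is\<in>multi_indices m I. is ! k = i}"
  have "(\<Sum>is\<in>?B k. A is * (\<Prod>l\<in>{..<m} - {k}. x (is ! l)))
      = (\<Sum>is\<in>?B 0. A is * (\<Prod>l\<in>{..<m} - {0}. x (is ! l)))"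
  proof (rule sum.reindex_bij_witness[of _ "permute_list \<tau>" "permute_list \<tau>"])
    fix "is" assume "is \<in> ?B k"
    then have "is": "is \<in> multi_indices m I" "is ! k = i" by auto
    show "permute_list \<tau> (permute_list \<tau> is) = is" by (rule inv) fact
    show "permute_list \<tau> is \<in> ?B 0" using "is" mem nth[of "is" 0] m by (simp add: \<tau>_def)
    have "(\<Prod>l\<in>{..<m} - {0}. x (permute_list \<tau> is ! l)) = (\<Prod>l\<in>{..<m} - {k}. x (is ! l))"
      by (rule prod.reindex_bij_witness[of _ \<tau> \<tau>])
        (use "is" in \<open>simp_all add: \<tau>\<tau> \<tau>_less nth \<tau>_eq\<close>)
    moreover have "A (permute_list \<tau> is) = A is"
      using assms(1) "is" \<tau> by (simp add: symmetric_tensor_def)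
    ultimately show "A (permute_list \<tau> is) * (\<Prod>l\<in>{..<m} - {0}. x (permute_list \<tau> is ! l))
        = A is * (\<Prod>l\<in>{..<m} - {k}. x (is ! l))" by simp
  next
    fix "is" assume "is \<in> ?B 0"
    then have "is": "is \<in> multi_indices m I" "is ! 0 = i" by auto
    show "permute_list \<tau> (permute_list \<tau> is) = is" by (rule inv) fact
    show "permute_list \<tau> is \<in> ?B k"
      using "is" mem nth[of "is" k] assms(3) by (simp add: \<tau>_def)
  qed
  also have "\<dots> = tensor_vec m I A x i"
  proof -
    have "{..<m} - {0} = Suc ` {..<m - 1}"
      using m by (cases m) (auto simp: lessThan_Suc_eq_insert_0)
    then have tail: "(\<Prod>l\<in>{..<m} - {0}. x ((i # js) ! l)) = prod_list (map x js)"
      if "js \<in> multi_indices (m - 1) I" for js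
      using that by (simp add: prod.reindex prod_list_map_eq_prod multi_indices_def)
    have "?B 0 = (#) i ` multi_indices (m - 1) I"
      using assms(2) m multi_indices_Suc[of "m - 1" I] by auto
    then show ?thesis
      unfolding tensor_vec_def by (simp add: sum.reindex tail del: nth_Cons_pos)
  qed
  finally show ?thesis .
qed

lemma tensor_form_has_partial_derivative:
  assumes "symmetric_tensor m I A" and "m \<ge> 1" and "finite I" and "i \<in> I"
  shows "((\<lambda>t. tensor_form m I A (\<lambda>j. x j + (if j = i then t else 0)))
    has_real_derivative real m * tensor_vec m I A x i) (at 0)"
proof -
  let ?d = "\<lambda>j. if j = i then 1 else (0::real)"
  have slot: "((\<lambda>t. x j + (if j = i then t else 0)) has_real_derivative ?d j) (at 0)" for j
    by (cases "j = i") (auto intro!: derivative_eq_intros)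
  have prod: "((\<lambda>t. \<Prod>l<m. x (is ! l) + (if is ! l = i then t else 0)) has_real_derivative
      (\<Sum>k<m. ?d (is ! k) * (\<Prod>l\<in>{..<m} - {k}. x (is ! l)))) (at 0)" for "is"
    using has_field_derivative_prod[of "{..<m}"
        "\<lambda>l t. x (is ! l) + (if is ! l = i then t else 0)" "\<lambda>l. ?d (is ! l)" 0, OF slot]
    by simp
  have "((\<lambda>t. tensor_form m I A (\<lambda>j. x j + (if j = i then t else 0))) has_real_derivative
      (\<Sum>is\<in>multi_indices m I. A is * (\<Sum>k<m. ?d (is ! k) * (\<Prod>l\<in>{..<m} - {k}. x (is ! l))))) (at 0)"
    unfolding tensor_form_eq_sum[OF assms(2)] by (intro DERIV_sum DERIV_cmult prod)
  also have "(\<Sum>is\<in>multi_indices m I. A is * (\<Sum>k<m. ?d (is ! k) * (\<Prod>l\<in>{..<m} - {k}. x (is ! l))))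
      = (\<Sum>k<m. \<Sum>is\<in>multi_indices m I.
          if is ! k = i then A is * (\<Prod>l\<in>{..<m} - {k}. x (is ! l)) else 0)"
    unfolding sum_distrib_left
    by (subst sum.swap) (intro sum.cong refl, simp)
  also have "\<dots> = (\<Sum>k<m. tensor_vec m I A x i)"
    by (intro sum.cong refl)
      (simp add: symmetric_tensor_contract_slot[OF assms(1,4), symmetric]
        sum.inter_filter finite_multi_indices assms(3))
  finally show ?thesis by simp
qed

section \<open>Minimising the form on the simplex\<close>

text \<open>
  A minimiser on the standard simplex, with the minimality stated homogeneously for the whole
  nonnegative orthant.
\<close>

lemma tensor_form_minimiser_exists:
  fixes I :: "'i set"
  assumes "m \<ge> 1" and "finite I" and "I \<noteq> {}"
  obtains x where "\<And>i. i \<in> I \<Longrightarrow> x i \<ge> 0" and "sum x I = 1"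
    and "\<And>y. (\<And>i. i \<in> I \<Longrightarrow> y i \<ge> 0) \<Longrightarrow> tensor_form m I A x * sum y I ^ m \<le> tensor_form m I A y"
proof -
  \<comment> \<open>vectors are extended by \<open>0\<close> outside \<open>I\<close>, to get a compact set in the product topology\<close>
  define S where "S = (\<lambda>i. if i \<in> I then {0..1} else {0::real})"
  define K where "K = PiE UNIV S \<inter> {x. sum x I = 1}"
  have coord: "continuous_on UNIV (\<lambda>x :: 'i \<Rightarrow> real. x i)" for i
    by (rule continuous_on_product_coordinates)
  have "compactin (product_topology (\<lambda>i. euclidean) UNIV) (PiE UNIV S)"
    by (subst compactin_PiE) (auto simp: S_def)
  then have "compact (PiE UNIV S)"
    by (simp add: euclidean_product_topology)
  moreover have "closed {x :: 'i \<Rightarrow> real. sum x I = 1}"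
    by (intro closed_Collect_eq continuous_on_sum coord continuous_on_const)
  ultimately have "compact K" unfolding K_def by (rule compact_Int_closed)
  moreover have "K \<noteq> {}"
  proof -
    obtain i where "i \<in> I" using assms(3) by auto
    then have "(\<lambda>j. if j = i then 1 else 0) \<in> K"
      using assms(2) by (auto simp: K_def S_def)
    then show ?thesis by auto
  qed
  moreover have "continuous_on K (tensor_form m I A)"
  proof -
    have "continuous_on UNIV (tensor_form m I A)"
      unfolding tensor_form_eq_sum[OF assms(1), abs_def]
      by (intro continuous_on_sum continuous_on_mult continuous_on_const continuous_on_prod coord)
    then show ?thesis by (rule continuous_on_subset) auto
  qed
  ultimately obtain x where x: "x \<in> K"
    and min: "\<And>y. y \<in> K \<Longrightarrow> tensor_form m I A x \<le> tensor_form m I A y"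
    using continuous_attains_inf[of K "tensor_form m I A"] by auto
  have "tensor_form m I A x * sum y I ^ m \<le> tensor_form m I A y"
    if y: "\<And>i. i \<in> I \<Longrightarrow> y i \<ge> 0" for y
  proof (cases "sum y I = 0")
    case True
    then have "y i = 0" if "i \<in> I" for i
      using that y assms(2) by (simp add: sum_nonneg_eq_0_iff)
    then have "tensor_form m I A y = 0" by (simp add: tensor_form_def)
    then show ?thesis using True assms(1) by (simp add: power_0_left)
  next
    case False
    then have pos: "sum y I > 0" using y by (simp add: sum_nonneg order_le_neq_trans)
    define z where "z = (\<lambda>i. if i \<in> I then y i / sum y I else 0)"
    have "y i \<le> sum y I" if "i \<in> I" for i using that y assms(2) by (auto intro: member_le_sum)
    moreover have "sum z I = 1" using pos by (simp add: z_def flip: sum_divide_distrib)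
    ultimately have "z \<in> K" using pos y by (auto simp: K_def S_def z_def)
    then have "tensor_form m I A x * sum y I ^ m \<le> tensor_form m I A z * sum y I ^ m"
      using min pos by (intro mult_right_mono) auto
    also have "\<dots> = tensor_form m I A (\<lambda>i. sum y I * z i)"
      using assms(1) by (simp add: tensor_form_scale)
    also have "\<dots> = tensor_form m I A y"
      using assms(1) False by (intro tensor_form_cong) (auto simp: z_def)
    finally show ?thesis .
  qed
  moreover have "x i \<ge> 0" if "i \<in> I" for i
    using x that by (auto simp: K_def S_def PiE_iff split: if_splits dest: spec[of _ i])
  moreover have "sum x I = 1" using x by (simp add: K_def)
  ultimately show ?thesis using that by blast
qed

text \<open>
  The first-order condition at the minimiser: all components of \<open>A x\<^sup>m\<^sup>-\<^sup>1\<close> on its support equal the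
  minimum of the form.
\<close>

lemma not_copositive_imp_negative_on_support:
  assumes "symmetric_tensor m I A" and "m \<ge> 1" and "finite I" and "\<not> copositive m I A"
  obtains x where "\<And>i. i \<in> I \<Longrightarrow> x i \<ge> 0" and "\<exists>i\<in>I. x i \<noteq> 0" and "tensor_form m I A x < 0"
    and "\<And>i. i \<in> I \<Longrightarrow> x i > 0 \<Longrightarrow> tensor_vec m I A x i < 0"
proof -
  obtain y where y: "\<And>i. i \<in> I \<Longrightarrow> y i \<ge> 0" and neg: "tensor_form m I A y < 0"
    using assms(4) by (auto simp: copositive_def not_le)
  have "I \<noteq> {}" using neg by (auto simp: tensor_form_def)
  with assms(2,3) obtain x where x: "\<And>i. i \<in> I \<Longrightarrow> x i \<ge> 0" and sum1: "sum x I = 1"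
    and min: "\<And>y. (\<And>i. i \<in> I \<Longrightarrow> y i \<ge> 0) \<Longrightarrow>
      tensor_form m I A x * sum y I ^ m \<le> tensor_form m I A y"
    using tensor_form_minimiser_exists[of m I A] by blast
  define c where "c = tensor_form m I A x"
  have "c * sum y I ^ m < 0" using min[of y] y neg by (simp add: c_def)
  moreover have "sum y I ^ m \<ge> 0" using y by (simp add: sum_nonneg)
  ultimately have c: "c < 0" by (meson not_le mult_nonneg_nonneg)
  have vec: "tensor_vec m I A x i < 0" if i: "i \<in> I" "x i > 0" for i
  proof -
    let ?x = "\<lambda>t j. x j + (if j = i then t else 0)"
    define g where "g = (\<lambda>t. tensor_form m I A (?x t) - c * (1 + t) ^ m)"
    have "(g has_real_derivative real m * tensor_vec m I A x i - c * real m) (at 0)"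
      unfolding g_def
      by (rule DERIV_diff tensor_form_has_partial_derivative[OF assms(1-3) i(1)])+
        (auto intro!: derivative_eq_intros)
    moreover have "g 0 \<le> g t" if "\<bar>0 - t\<bar> < x i" for t
    proof -
      have "sum (?x t) I = 1 + t" using i(1) assms(3) sum1 by (simp add: sum.distrib)
      moreover have "?x t j \<ge> 0" if "j \<in> I" for j using x[OF that] \<open>\<bar>0 - t\<bar> < x i\<close> by auto
      ultimately have "c * (1 + t) ^ m \<le> tensor_form m I A (?x t)"
        using min[of "?x t"] by (simp add: c_def)
      then show ?thesis by (simp add: g_def c_def)
    qed
    ultimately have "real m * tensor_vec m I A x i - c * real m = 0"
      using DERIV_local_min[of g _ 0 "x i"] i(2) by blast
    then have "tensor_vec m I A x i = c" using assms(2) by (simp add: mult.commute[of c])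
    then show ?thesis using c by simp
  qed
  moreover have "\<exists>i\<in>I. x i \<noteq> 0" using sum1 by (metis sum.neutral zero_neq_one)
  ultimately show ?thesis using that[of x] x c by (simp add: c_def)
qed

section \<open>Semi-positivity and copositivity\<close>

lemma tensor_form_neg:
  assumes "finite I" and "\<And>i. i \<in> I \<Longrightarrow> x i \<ge> 0" and "\<exists>i\<in>I. x i \<noteq> 0"
    and "\<And>i. i \<in> I \<Longrightarrow> x i > 0 \<Longrightarrow> tensor_vec m I A x i < 0"
  shows "tensor_form m I A x < 0"
proof -
  have le: "x i * tensor_vec m I A x i \<le> 0" if "i \<in> I" for i
    using assms(2,4)[OF that] by (cases "x i = 0") (auto simp: mult_le_0_iff)
  obtain k where "k \<in> I" "x k > 0" using assms(2,3) by (metis order_le_neq_trans)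
  then have "x k * tensor_vec m I A x k < 0" using assms(4) by (simp add: mult_pos_neg)
  then have "(\<Sum>i\<in>I. x i * tensor_vec m I A x i) < (\<Sum>i\<in>I. 0)"
    using assms(1) le \<open>k \<in> I\<close> by (intro sum_strict_mono_ex1) auto
  then show ?thesis by (simp add: tensor_form_def)
qed

lemma symmetric_semi_positive_iff_copositive:
  fixes I :: "'i set"
  assumes "symmetric_tensor m I A" and "m \<ge> 1" and "finite I"
  shows "semi_positive m I A \<longleftrightarrow> copositive m I A"
proof
  assume semi: "semi_positive m I A"
  show "copositive m I A"
  proof (rule ccontr)
    assume "\<not> copositive m I A"
    then obtain x where x: "\<And>i. i \<in> I \<Longrightarrow> x i \<ge> 0" "\<exists>i\<in>I. x i \<noteq> 0"
      and "tensor_form m I A x < 0"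
      and neg: "\<And>i. i \<in> I \<Longrightarrow> x i > 0 \<Longrightarrow> tensor_vec m I A x i < 0"
      using not_copositive_imp_negative_on_support[OF assms] by blast
    have "\<exists>k\<in>I. x k > 0 \<and> tensor_vec m I A x k \<ge> 0"
      using semi x by (simp add: semi_positive_def)
    then show False using neg by (meson not_le)
  qed
next
  assume cop: "copositive m I A"
  show "semi_positive m I A"
    unfolding semi_positive_def
  proof (intro allI impI)
    fix x :: "'i \<Rightarrow> real"
    assume x: "(\<forall>i\<in>I. x i \<ge> 0) \<and> (\<exists>i\<in>I. x i \<noteq> 0)"
    show "\<exists>k\<in>I. x k > 0 \<and> tensor_vec m I A x k \<ge> 0"
    proof (rule ccontr)
      assume "\<not> (\<exists>k\<in>I. x k > 0 \<and> tensor_vec m I A x k \<ge> 0)"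
      then have "tensor_vec m I A x i < 0" if "i \<in> I" "x i > 0" for i
        using that by (simp add: not_le)
      then have "tensor_form m I A x < 0"
        using x by (intro tensor_form_neg[OF assms(3)]) blast+
      moreover have "tensor_form m I A x \<ge> 0" using cop x by (simp add: copositive_def)
      ultimately show False by simp
    qed
  qed
qed

theorem theorem14:
  fixes m n :: nat and A :: "nat list \<Rightarrow> real"
  assumes "m \<ge> 2" and "n \<ge> 1"
    and "symmetric_tensor m {1..n} A"
  shows "almost_semi_positive m {1..n} A \<longleftrightarrow> almost_copositive m {1..n} A"
proof -
  let ?I = "{1..n}"
  have m: "m \<ge> 1" using assms(1) by simp
  have sub: "semi_positive m J (principal_subtensor m J A)
      \<longleftrightarrow> copositive m J (principal_subtensor m J A)" if "J \<subset> ?I" for J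
    using that symmetric_semi_positive_iff_copositive[of m J A] assms(3) m
    by (simp add: semi_positive_principal_subtensor copositive_principal_subtensor
        symmetric_tensor_subset finite_subset[of J ?I] psubset_imp_subset)
  show ?thesis
  proof
    assume semi: "almost_semi_positive m ?I A"
    then obtain x where "\<forall>i\<in>?I. x i > 0" "\<forall>i\<in>?I. tensor_vec m ?I A x i < 0"
      by (auto simp: almost_semi_positive_def)
    moreover have "\<exists>i\<in>?I. x i \<noteq> 0"
      using calculation(1) assms(2) by (intro bexI[of _ 1]) force+
    ultimately have "tensor_form m ?I A x < 0" "\<forall>i\<in>?I. x i \<ge> 0"
      using tensor_form_neg[of ?I x m A] by (simp_all add: less_imp_le)
    then have "\<not> copositive m ?I A" by (auto simp: copositive_def not_le)
    then show "almost_copositive m ?I A"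
      using semi sub by (simp add: almost_copositive_def almost_semi_positive_def)
  next
    assume cop: "almost_copositive m ?I A"
    then have "\<not> copositive m ?I A" by (simp add: almost_copositive_def)
    then obtain x where x: "\<And>i. i \<in> ?I \<Longrightarrow> x i \<ge> 0" "\<exists>i\<in>?I. x i \<noteq> 0" "tensor_form m ?I A x < 0"
      "\<And>i. i \<in> ?I \<Longrightarrow> x i > 0 \<Longrightarrow> tensor_vec m ?I A x i < 0"
      using not_copositive_imp_negative_on_support[OF assms(3) m] by blast
    define S where "S = {i\<in>?I. x i \<noteq> 0}"
    have "S = ?I"
    proof (rule ccontr)
      assume "S \<noteq> ?I"
      then have "S \<noteq> {}" "S \<subset> ?I" using x(2) by (auto simp: S_def)
      then have "copositive m S A"
        using cop m by (simp add: almost_copositive_def copositive_principal_subtensor)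
      then have "tensor_form m S A x \<ge> 0" using x(1) by (auto simp: copositive_def S_def)
      moreover have "tensor_form m ?I A x = tensor_form m S A x"
        using m by (intro tensor_form_restrict_support) (auto simp: S_def)
      ultimately show False using x(3) by simp
    qed
    then have "\<forall>i\<in>?I. x i \<noteq> 0" unfolding S_def by blast
    then have "\<forall>i\<in>?I. x i > 0" using x(1) by (simp add: less_le)
    moreover from this have "\<forall>i\<in>?I. tensor_vec m ?I A x i < 0" using x(4) by blast
    moreover have "\<forall>J. J \<noteq> {} \<and> J \<subset> ?I \<longrightarrow> semi_positive m J (principal_subtensor m J A)"
      using cop sub unfolding almost_copositive_def by blast
    ultimately show "almost_semi_positive m ?I A"
      unfolding almost_semi_positive_def by blast
  qed
qed

end
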